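(* Let $(V,h,J,\omega)$ be a $2n$-dimensional Kähler vector space. The $U(n)$-submodules $$\mathcal{MC}_K(V^* )=\{X\in\mathcal{MC}(V^* ):J_i{}^aJ_j{}^bX_{abkl}=X_{ijkl}\}=\{X\in\mathcal{MC}(V^* ):J_{[i}{}^{p}X_{j]pkl}=0\}$$ and $\mathcal{MC}_{K,W}(V^* )=\mathcal{MC}_K(V^* )\cap\mathcal{MC}_W(V^* )$ are subalgebras of $(\mathcal{MC}(V^* ),\ast)$ on which $U(n)$ acts by automorphisms.
   Context: All vector spaces are finite-dimensional over $\mathbb{R}$; indices are raised and lowered with $h$; brackets around indices denote complete antisymmetrization, normalized to be a projection. A $2n$-dimensional Kähler vector space $(V,h,J,\omega)$ is a Euclidean (positive definite) vector space $(V,h)$ of dimension $2n$ with a complex structure $J_i{}^j$ ($J_i{}^pJ_p{}^j=-\delta_i{}^j$) satisfying $J_i{}^pJ_j{}^qh_{pq}=h_{ij}$, and $\omega_{ij}=J_i{}^ph_{pj}$. $U(n)$ is identified with the group of linear automorphisms of $V$ preserving $h$ and $J$. $\mathcal{MC}(V^* )=\{Y_{ijkl}\in\otimes^4V^*: Y_{[ij]kl}=Y_{ijkl}=Y_{ij[kl]},\ Y_{[ijk]l}=0\}$; $\rho(Y)_{ij}=Y_{pij}{}^p$; $\mathcal{MC}_W(V^* )=\ker\rho$. For $X\in\mathcal{MC}(V^* )$, $\widehat X\in\operatorname{End}(\otimes^kV^* )$ is $\widehat X(\alpha)_{i_1\dots i_k}=\tfrac1k\sum_{r\ne s}X^{p}{}_{i_ri_s}{}^{q}\,\alpha_{i_1\dots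 p\dots q\dots i_k}$, the sum running over ordered pairs $(r,s)$ of distinct positions, with $p$ in position $r$ and $q$ in position $s$. The commutative multiplication on $\mathcal{MC}(V^* )$ is $X\ast Y:=\widehat X(Y)$. *)

theory Defs
  imports
    "HOL-Analysis.Analysis"
    "HOL-Combinatorics.Permutations"
    "HOL-Library.Function_Algebras"
begin

text \<open>
  The Euclidean vector space \<open>(V, h)\<close> is an arbitrary type \<open>'a\<close> of class \<^class>\<open>euclidean_space\<close>; the metric
  \<open>h\<close> is the inner product of that class. Index contractions are sums over the orthonormal
  basis \<^const>\<open>Basis\<close>, with respect to which raising and lowering an index with \<open>h\<close> does not change
  components.
\<close>

instantiation "fun" :: (type, real_vector) real_vector
begin

definition scaleR_fun :: "real \<Rightarrow> ('a \<Rightarrow> 'b) \<Rightarrow> 'a \<Rightarrow> 'b"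
  where "scaleR_fun c f = (\<lambda>x. c *\<^sub>R f x)"

instance
  by standard (auto simp: scaleR_fun_def plus_fun_def scaleR_add_right scaleR_add_left)

end


subsection \<open>Covariant tensors\<close>

text \<open>
  A covariant \<open>k\<close>-tensor \<open>\<alpha>\<close> is a \<open>k\<close>-linear form, taking the list of its arguments; \<open>\<alpha>\<close> vanishes on
  lists of other lengths, so that equality of functions is equality of tensors. Positions are counted from \<open>0\<close>.
\<close>

definition tensors :: "nat \<Rightarrow> ('a::euclidean_space list \<Rightarrow> real) set"
  where "tensors k = {\<alpha>.
    (\<forall>vs r. length vs = k \<longrightarrow> r < k \<longrightarrow> linear (\<lambda>x. \<alpha> (vs[r := x]))) \<and>
    (\<forall>vs. length vs \<noteq> k \<longrightarrow> \<alpha> vs = 0)}"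

text \<open>Antisymmetrization over the positions in \<open>S\<close>, normalized to be a projection.\<close>

definition antisymmetrize :: "nat set \<Rightarrow> ('a list \<Rightarrow> real) \<Rightarrow> 'a list \<Rightarrow> real"
  where "antisymmetrize S \<alpha> = (\<lambda>vs.
    (\<Sum>\<pi> | \<pi> permutes S. of_int (sign \<pi>) * \<alpha> (permute_list \<pi> vs)) / fact (card S))"


subsection \<open>Metric curvature tensors\<close>

definition MC :: "('a::euclidean_space list \<Rightarrow> real) set"
  where "MC = {Y \<in> tensors 4.
    antisymmetrize {0, 1} Y = Y \<and> antisymmetrize {2, 3} Y = Y \<and> antisymmetrize {0, 1, 2} Y = 0}"

text \<open>\<open>\<rho>(Y)\<^sub>i\<^sub>j = Y\<^sub>p\<^sub>i\<^sub>j\<^sup>p\<close>\<close>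

definition ricci :: "('a::euclidean_space list \<Rightarrow> real) \<Rightarrow> 'a list \<Rightarrow> real"
  where "ricci Y = (\<lambda>vs. case vs of [x, y] \<Rightarrow> (\<Sum>p\<in>Basis. Y [p, x, y, p]) | _ \<Rightarrow> 0)"

definition MC_W :: "('a::euclidean_space list \<Rightarrow> real) set"
  where "MC_W = {Y \<in> MC. ricci Y = 0}"

text \<open>
  In components, \<open>hat k X \<alpha>\<close> is \<open>1/k\<close> times the sum, over ordered pairs \<open>(r, s)\<close> of distinct positions, of
  the contractions of \<open>X\<^sup>p\<^sub>i\<^sub>j\<^sup>q\<close> (\<open>i\<close>, \<open>j\<close> the indices of \<open>\<alpha>\<close> at \<open>r\<close>, \<open>s\<close>) with \<open>\<alpha>\<close>, in which \<open>p\<close> stands at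
  position \<open>r\<close> and \<open>q\<close> at position \<open>s\<close>.
\<close>

definition hat ::
    "nat \<Rightarrow> ('a::euclidean_space list \<Rightarrow> real) \<Rightarrow> ('a list \<Rightarrow> real) \<Rightarrow> 'a list \<Rightarrow> real"
  where "hat k X \<alpha> = (\<lambda>vs. if length vs = k
    then 1 / real k * (\<Sum>(r, s) \<in> {(r, s). r < k \<and> s < k \<and> r \<noteq> s}.
      \<Sum>p\<in>Basis. \<Sum>q\<in>Basis. X [p, vs ! r, vs ! s, q] * \<alpha> (vs[r := p, s := q]))
    else 0)"

definition curv_mult ::
    "('a::euclidean_space list \<Rightarrow> real) \<Rightarrow> ('a list \<Rightarrow> real) \<Rightarrow> 'a list \<Rightarrow> real"
  where "curv_mult X Y = hat 4 X Y"


subsection \<open>Kaehler vector spaces\<close>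

text \<open>
  The endomorphism \<open>J\<^sub>i\<^sup>j\<close> acts on vectors by \<open>(J v)\<^sup>j = v\<^sup>i J\<^sub>i\<^sup>j\<close>, so replacing an index \<open>i\<close> of a
  covariant tensor by \<open>a\<close> and contracting with \<open>J\<^sub>i\<^sup>a\<close> inserts \<open>J v\<close> in place of \<open>v\<close>.
\<close>

definition kaehler_vector_space ::
    "nat \<Rightarrow> ('a::euclidean_space \<Rightarrow> 'a) \<Rightarrow> ('a \<Rightarrow> 'a \<Rightarrow> real) \<Rightarrow> bool"
  where "kaehler_vector_space n J \<omega> \<longleftrightarrow>
    DIM('a) = 2 * n \<and> linear J \<and> (\<forall>x. J (J x) = - x) \<and>
    (\<forall>x y. J x \<bullet> J y = x \<bullet> y) \<and> (\<forall>x y. \<omega> x y = J x \<bullet> y)"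

definition unitary_group :: "('a::euclidean_space \<Rightarrow> 'a) \<Rightarrow> ('a \<Rightarrow> 'a) set"
  where "unitary_group J = {g. linear g \<and> bij g \<and>
    (\<forall>x y. g x \<bullet> g y = x \<bullet> y) \<and> (\<forall>x. g (J x) = J (g x))}"

text \<open>The action of \<open>GL(V)\<close> on covariant tensors.\<close>

definition tensor_act :: "('a \<Rightarrow> 'a) \<Rightarrow> ('a list \<Rightarrow> real) \<Rightarrow> 'a list \<Rightarrow> real"
  where "tensor_act g \<alpha> = (\<lambda>vs. \<alpha> (map (inv g) vs))"

definition MC_K :: "('a::euclidean_space \<Rightarrow> 'a) \<Rightarrow> ('a list \<Rightarrow> real) set"
  where "MC_K J = {X \<in> MC. \<forall>x y z w. X [J x, J y, z, w] = X [x, y, z, w]}"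

definition MC_KW :: "('a::euclidean_space \<Rightarrow> 'a) \<Rightarrow> ('a list \<Rightarrow> real) set"
  where "MC_KW J = MC_K J \<inter> MC_W"

text \<open>The tensor \<open>J\<^sub>i\<^sup>p X\<^sub>j\<^sub>p\<^sub>k\<^sub>l\<close>, as a tensor in \<open>i\<close>, \<open>j\<close>, \<open>k\<close>, \<open>l\<close> in this order.\<close>

definition J_contraction ::
    "('a \<Rightarrow> 'a) \<Rightarrow> ('a list \<Rightarrow> real) \<Rightarrow> 'a list \<Rightarrow> real"
  where "J_contraction J X =
    (\<lambda>vs. case vs of [x, y, z, w] \<Rightarrow> X [y, J x, z, w] | _ \<Rightarrow> 0)"


subsection \<open>Submodules, subalgebras and actions by automorphisms\<close>

definition submodule_of ::
    "'g set \<Rightarrow> ('g \<Rightarrow> 'v \<Rightarrow> 'v) \<Rightarrow> 'v::real_vector set \<Rightarrow> 'v set \<Rightarrow> bool"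
  where "submodule_of G act A M \<longleftrightarrow>
    M \<subseteq> A \<and> subspace M \<and> (\<forall>g\<in>G. \<forall>X\<in>M. act g X \<in> M)"

definition subalgebra_of ::
    "'v::real_vector set \<Rightarrow> ('v \<Rightarrow> 'v \<Rightarrow> 'v) \<Rightarrow> 'v set \<Rightarrow> bool"
  where "subalgebra_of A prd B \<longleftrightarrow>
    B \<subseteq> A \<and> subspace B \<and> (\<forall>X\<in>B. \<forall>Y\<in>B. prd X Y \<in> B)"

definition algebra_automorphism ::
    "'v::real_vector set \<Rightarrow> ('v \<Rightarrow> 'v \<Rightarrow> 'v) \<Rightarrow> ('v \<Rightarrow> 'v) \<Rightarrow> bool"
  where "algebra_automorphism B prd \<phi> \<longleftrightarrow>
    bij_betw \<phi> B B \<and>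
    (\<forall>X\<in>B. \<forall>Y\<in>B. \<phi> (X + Y) = \<phi> X + \<phi> Y) \<and>
    (\<forall>c. \<forall>X\<in>B. \<phi> (c *\<^sub>R X) = c *\<^sub>R \<phi> X) \<and>
    (\<forall>X\<in>B. \<forall>Y\<in>B. \<phi> (prd X Y) = prd (\<phi> X) (\<phi> Y))"

text \<open>\<open>G\<close> is a group of transformations, with composition as its multiplication.\<close>

definition acts_by_automorphisms ::
    "('u \<Rightarrow> 'u) set \<Rightarrow> (('u \<Rightarrow> 'u) \<Rightarrow> 'v \<Rightarrow> 'v) \<Rightarrow> 'v::real_vector set \<Rightarrow> ('v \<Rightarrow> 'v \<Rightarrow> 'v) \<Rightarrow> bool"
  where "acts_by_automorphisms G act B prd \<longleftrightarrow>
    (\<forall>g\<in>G. algebra_automorphism B prd (act g)) \<and>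
    (\<forall>X\<in>B. act id X = X) \<and>
    (\<forall>g\<in>G. \<forall>g'\<in>G. \<forall>X\<in>B. act (g \<circ> g') X = act g (act g' X))"

end

theory Submission
  imports Defs
begin

text \<open>
  The operator \<open>hat k X\<close> sums over all pairs of positions, so it commutes with permutations of the
  positions, and the symmetries defining \<open>MC\<close> pass from \<open>Y\<close> to \<open>curv_mult X Y\<close>. In the Ricci trace of
  \<open>curv_mult X Y\<close>, the terms where neither or both of the modified positions are traced contain
  \<open>ricci X\<close> or \<open>ricci Y\<close>; the remaining eight cancel in pairs, each being a contraction of an
  antisymmetric index pair of \<open>X\<close> with a symmetric one. Since contractions are invariant under
  orthogonal changes of basis, \<open>hat\<close> is equivariant; the same change of basis, by \<open>J\<close> itself, moves a
  pair of \<open>J\<close>'s across a contracted index and gives \<open>J\<close>-invariance of the product, once the Bianchi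
  identity has turned the terms \<open>X\<^sub>p\<^sub>i\<^sub>j\<^sub>q Y\<^sub>p\<^sub>q\<^sub>k\<^sub>l\<close> into \<open>X\<^sub>q\<^sub>p\<^sub>i\<^sub>j Y\<^sub>p\<^sub>q\<^sub>k\<^sub>l\<close>.
\<close>

section \<open>Contractions over an orthonormal basis\<close>

lemma sum_orthogonal_invariant:
  fixes g :: "'a::euclidean_space \<Rightarrow> 'a" and B :: "'a \<Rightarrow> 'a \<Rightarrow> real"
  assumes "orthogonal_transformation g" and "bilinear B"
  shows "(\<Sum>b\<in>Basis. B (g b) (g b)) = (\<Sum>b\<in>Basis. B b b)"
proof -
  have inn: "g b \<bullet> c = b \<bullet> inv g c" for b c
  proof -
    have "g b \<bullet> g (inv g c) = b \<bullet> inv g c"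
      using assms(1) by (simp add: orthogonal_transformation_def)
    then show ?thesis
      by (simp add: surj_f_inv_f[OF orthogonal_transformation_surj[OF assms(1)]])
  qed
  \<comment> \<open>Expanding both arguments in the basis gives the coefficients
    \<open>b \<bullet> inv g c\<close> and \<open>b \<bullet> inv g d\<close>. Summed over
    \<open>b\<close> they form \<open>inv g c \<bullet> inv g d\<close>, a Kronecker delta because
    \<open>inv g\<close> is orthogonal as well.\<close>
  have "B (g b) (g b) = (\<Sum>c\<in>Basis. \<Sum>d\<in>Basis. (b \<bullet> inv g c) * (b \<bullet> inv g d) * B c d)" for b
  proof -
    have "B (g b) (g b) = B (\<Sum>c\<in>Basis. (g b \<bullet> c) *\<^sub>R c) (\<Sum>d\<in>Basis. (g b \<bullet> d) *\<^sub>R d)"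
      by (simp add: euclidean_representation)
    also have "\<dots> = (\<Sum>c\<in>Basis. \<Sum>d\<in>Basis. B ((g b \<bullet> c) *\<^sub>R c) ((g b \<bullet> d) *\<^sub>R d))"
      by (subst bilinear_sum[OF assms(2)]) (simp_all add: sum.cartesian_product)
    finally show ?thesis
      using assms(2) by (simp add: bilinear_lmul bilinear_rmul inn mult.assoc)
  qed
  then have "(\<Sum>b\<in>Basis. B (g b) (g b)) =
      (\<Sum>b\<in>Basis. \<Sum>c\<in>Basis. \<Sum>d\<in>Basis. (b \<bullet> inv g c) * (b \<bullet> inv g d) * B c d)"
    by simp
  also have "\<dots> = (\<Sum>c\<in>Basis. \<Sum>b\<in>Basis. \<Sum>d\<in>Basis. (b \<bullet> inv g c) * (b \<bullet> inv g d) * B c d)"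
    by (rule sum.swap)
  also have "\<dots> = (\<Sum>c\<in>Basis. \<Sum>d\<in>Basis. \<Sum>b\<in>Basis. (b \<bullet> inv g c) * (b \<bullet> inv g d) * B c d)"
    by (intro sum.cong refl sum.swap)
  also have "\<dots> = (\<Sum>c\<in>Basis. \<Sum>d\<in>Basis. (inv g c \<bullet> inv g d) * B c d)"
    by (simp add: euclidean_inner[of "inv g _" "inv g _"] sum_distrib_right inner_commute)
  also have "\<dots> = (\<Sum>c\<in>Basis. \<Sum>d\<in>Basis. (c \<bullet> d) * B c d)"
    using orthogonal_transformation_inv[OF assms(1)] by (simp add: orthogonal_transformation_def)
  also have "\<dots> = (\<Sum>c\<in>Basis. \<Sum>d\<in>Basis. (if d = c then B c d else 0))"
    by (intro sum.cong refl) (auto simp: inner_Basis)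
  also have "\<dots> = (\<Sum>c\<in>Basis. B c c)"
    by simp
  finally show ?thesis .
qed

lemma sum_antisymmetric_eq_0:
  fixes F :: "'a \<Rightarrow> 'a \<Rightarrow> real"
  assumes "\<And>x y. F x y = - F y x"
  shows "(\<Sum>x\<in>A. \<Sum>y\<in>A. F x y) = 0"
proof -
  have "(\<Sum>x\<in>A. \<Sum>y\<in>A. F x y) = (\<Sum>y\<in>A. \<Sum>x\<in>A. F x y)"
    by (rule sum.swap)
  also have "\<dots> = (\<Sum>y\<in>A. \<Sum>x\<in>A. - F y x)"
    using assms by (intro sum.cong refl)
  finally show ?thesis
    by (simp add: sum_negf)
qed

text \<open>In a contraction of \<open>X\<close> with a second tensor, each summation index enters
  linearly once through either factor. This puts such summands into the form required by
  \<open>sum_orthogonal_invariant\<close>.\<close>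

lemma bilinear_mult:
  fixes f g :: "'a::real_vector \<Rightarrow> real"
  assumes "linear f" "linear g"
  shows "bilinear (\<lambda>x y. f x * g y)"
  using assms by (simp add: bilinear_def linear_iff algebra_simps)

section \<open>Covariant tensors as multilinear forms\<close>

lemma tensors_linear:
  assumes "\<alpha> \<in> tensors k" "length vs = k" "r < k"
  shows "linear (\<lambda>x. \<alpha> (vs[r := x]))"
  using assms by (auto simp: tensors_def)

lemma tensors_eq_0: "\<alpha> \<in> tensors k \<Longrightarrow> length vs \<noteq> k \<Longrightarrow> \<alpha> vs = 0"
  by (auto simp: tensors_def)

lemma tensors_4_linear:
  assumes "X \<in> tensors 4"
  shows "linear (\<lambda>x. X [x, b, c, d])" "linear (\<lambda>x. X [a, x, c, d])"
    "linear (\<lambda>x. X [a, b, x, d])" "linear (\<lambda>x. X [a, b, c, x])"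
  using tensors_linear[OF assms, of "[0, b, c, d]" 0] tensors_linear[OF assms, of "[a, 0, c, d]" 1]
    tensors_linear[OF assms, of "[a, b, 0, d]" 2] tensors_linear[OF assms, of "[a, b, c, 0]" 3]
  by simp_all

lemma length_4_cases:
  assumes "length vs = 4" obtains a b c d where "vs = [a, b, c, d]"
  using assms by (auto simp: numeral_eq_Suc length_Suc_conv)

lemma subspace_tensors: "subspace (tensors k)"
  unfolding subspace_def tensors_def
  by (auto simp: linear_iff scaleR_fun_def plus_fun_def zero_fun_def algebra_simps)


subsection \<open>Antisymmetrization\<close>

lemma antisymmetrize_add: "antisymmetrize S (\<alpha> + \<beta>) = antisymmetrize S \<alpha> + antisymmetrize S \<beta>"
  by (simp add: antisymmetrize_def plus_fun_def distrib_left sum.distrib add_divide_distrib)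

lemma antisymmetrize_scaleR: "antisymmetrize S (c *\<^sub>R \<alpha>) = c *\<^sub>R antisymmetrize S \<alpha>"
  by (simp add: antisymmetrize_def scaleR_fun_def sum_distrib_left mult.left_commute)

lemma antisymmetrize_0: "antisymmetrize S 0 = 0"
  by (simp add: antisymmetrize_def zero_fun_def)

lemma antisymmetrize_pair:
  assumes "i \<noteq> j"
  shows "antisymmetrize {i, j} \<alpha> vs = (\<alpha> vs - \<alpha> (permute_list (Transposition.transpose i j) vs)) / 2"
proof -
  have "{\<pi>. \<pi> permutes {i, j}} = {id, Transposition.transpose i j}"
    by (auto simp: permutes_doubleton_iff)
  moreover have "id \<noteq> Transposition.transpose i j"
    using assms by (metis id_apply transpose_apply_first)
  ultimately show ?thesis
    using assms by (simp add: antisymmetrize_def sign_swap_id)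
qed

lemma antisymmetrize_triple:
  assumes "i \<noteq> j" "i \<noteq> k" "j \<noteq> k"
  shows "antisymmetrize {i, j, k} \<alpha> vs =
    (\<alpha> vs - \<alpha> (permute_list (Transposition.transpose j k) vs)
      - \<alpha> (permute_list (Transposition.transpose i j) vs) + \<alpha> (permute_list (Transposition.transpose i j \<circ> Transposition.transpose j k) vs)
      - \<alpha> (permute_list (Transposition.transpose i k) vs) + \<alpha> (permute_list (Transposition.transpose i k \<circ> Transposition.transpose j k) vs)) / 6"
proof -
  have perms: "{\<pi>. \<pi> permutes {j, k}} = {id, Transposition.transpose j k}"
    by (auto simp: permutes_doubleton_iff)
  have ne: "id \<noteq> Transposition.transpose j k"
    using assms by (metis id_apply transpose_apply_first)
  \<comment> \<open>Each permutation of three points is uniquely a permutation \<open>q\<close> of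
    \<open>{j, k}\<close> followed by the transposition of \<open>i\<close> with some
    \<open>b\<close>; for \<open>b = i\<close> that transposition is the identity.\<close>
  have "(\<Sum>\<pi> | \<pi> permutes {i, j, k}. of_int (sign \<pi>) * \<alpha> (permute_list \<pi> vs)) =
     (\<Sum>b\<in>{i, j, k}. \<Sum>q\<in>{id, Transposition.transpose j k}.
        of_int (sign (Transposition.transpose i b \<circ> q)) * \<alpha> (permute_list (Transposition.transpose i b \<circ> q) vs))"
    using assms by (subst sum_over_permutations_insert) (auto simp: perms)
  then show ?thesis
    using assms ne
    by (simp add: antisymmetrize_def sign_swap_id sign_compose permutation_swap_id card_insert_if fact_numeral)
qed

lemma permute_list_simps_4:
  "permute_list f [a, b, c, d] = [[a, b, c, d] ! f 0, [a, b, c, d] ! f 1, [a, b, c, d] ! f 2, [a, b, c, d] ! f 3]"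
  by (simp add: permute_list_def upt_rec numeral_eq_Suc)

section \<open>Component form of the curvature symmetries\<close>

lemma MC_D:
  assumes "Y \<in> MC"
  shows "Y \<in> tensors 4" "Y [b, a, c, d] = - Y [a, b, c, d]" "Y [a, b, d, c] = - Y [a, b, c, d]"
    "Y [a, b, c, d] + Y [b, c, a, d] + Y [c, a, b, d] = 0"
proof -
  have Y: "Y \<in> tensors 4" "antisymmetrize {0, 1} Y = Y" "antisymmetrize {2, 3} Y = Y"
    "antisymmetrize {0, 1, 2} Y = 0"
    using assms by (auto simp: MC_def)
  show "Y \<in> tensors 4" by fact
  have 1: "Y [b, a, c, d] = - Y [a, b, c, d]" for a b c d
    using fun_cong[OF Y(2), of "[a, b, c, d]"]
    by (simp add: antisymmetrize_pair permute_list_simps_4 Transposition.transpose_def)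
  then show "Y [b, a, c, d] = - Y [a, b, c, d]" .
  show "Y [a, b, d, c] = - Y [a, b, c, d]"
    using fun_cong[OF Y(3), of "[a, b, c, d]"]
    by (simp add: antisymmetrize_pair permute_list_simps_4 Transposition.transpose_def)
  \<comment> \<open>Antisymmetry in the first two arguments turns each odd permutation into the
    negative of a cyclic one, so the six terms are twice the cyclic sum.\<close>
  show "Y [a, b, c, d] + Y [b, c, a, d] + Y [c, a, b, d] = 0"
    using fun_cong[OF Y(4), of "[a, b, c, d]"] 1[of b a c d] 1[of b c a d] 1[of c a b d]
    by (simp add: antisymmetrize_triple permute_list_simps_4 Transposition.transpose_def)
qed

text \<open>The classical argument: four Bianchi identities, each with a different argument in the
  last place, combine linearly once the antisymmetries have identified their terms.\<close>

lemma MC_pair_symmetry: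
  assumes "Y \<in> MC"
  shows "Y [c, d, a, b] = Y [a, b, c, d]"
proof -
  note anti = MC_D(2,3)[OF assms] and bianchi = MC_D(4)[OF assms]
  have "Y [b, c, d, a] = - Y [b, c, a, d]" "Y [c, d, b, a] = - Y [c, d, a, b]"
    "Y [d, a, c, b] = - Y [d, a, b, c]" "Y [a, b, d, c] = - Y [a, b, c, d]"
    by (rule anti(2))+
  moreover have "Y [a, c, d, b] = Y [c, a, b, d]" "Y [d, b, c, a] = Y [b, d, a, c]"
    by (subst anti(1), subst anti(2), simp)+
  ultimately show ?thesis
    using bianchi[of a b c d] bianchi[of b c d a] bianchi[of c d a b] bianchi[of d a b c]
    by linarith
qed

lemma subspace_MC: "subspace (MC :: ('a::euclidean_space list \<Rightarrow> real) set)"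
  using subspace_tensors[of 4, where 'a = 'a]
  unfolding subspace_def MC_def
  by (auto simp: antisymmetrize_add antisymmetrize_scaleR antisymmetrize_0)


subsection \<open>The curvature product\<close>

lemma hat_mem_tensors:
  assumes X: "X \<in> tensors 4" and \<alpha>: "\<alpha> \<in> tensors k"
  shows "hat k X \<alpha> \<in> tensors k"
proof -
  have "linear (\<lambda>x. hat k X \<alpha> (vs[t := x]))" if vs: "length vs = k" and t: "t < k" for vs t
  proof -
    have "linear (\<lambda>x. X [p, vs[t := x] ! r, vs[t := x] ! s, q] * \<alpha> (vs[t := x, r := p, s := q]))"
      if rs: "r < k" "s < k" "r \<noteq> s" for r s p q
    proof -
      \<comment> \<open>For \<open>t = r\<close> or \<open>t = s\<close> the updates overwrite
        \<open>x\<close> in the argument of \<open>\<alpha>\<close>, so \<open>x\<close> enters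
        through \<open>X\<close> alone; otherwise it enters through \<open>\<alpha>\<close>
        alone.\<close>
      consider "t = r" | "t = s" | "t \<noteq> r" "t \<noteq> s" by blast
      then show ?thesis
      proof cases
        case 1
        then show ?thesis
          using rs vs tensors_4_linear(2)[OF X] by (simp add: linear_iff algebra_simps)
      next
        case 2
        then have "vs[t := x, r := p, s := q] = vs[r := p, s := q]" for x
          using rs by (simp add: list_update_swap)
        then show ?thesis
          using 2 rs vs tensors_4_linear(3)[OF X] by (simp add: linear_iff algebra_simps)
      next
        case 3
        then have "vs[t := x, r := p, s := q] = vs[r := p, s := q, t := x]" for x
          by (simp add: list_update_swap)
        then show ?thesis
          using 3 rs vs tensors_linear[OF \<alpha>, of "vs[r := p, s := q]" t] t
          by (simp add: linear_iff algebra_simps)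
      qed
    qed
    then have "linear (\<lambda>x. \<Sum>(r, s) \<in> {(r, s). r < k \<and> s < k \<and> r \<noteq> s}.
        \<Sum>p\<in>Basis. \<Sum>q\<in>Basis. X [p, vs[t := x] ! r, vs[t := x] ! s, q] * \<alpha> (vs[t := x, r := p, s := q]))"
      unfolding split_def by (intro linear_compose_sum ballI) auto
    from linear_compose_scale_right[OF this, of "1 / real k"] show ?thesis
      using vs by (simp add: hat_def)
  qed
  then show ?thesis
    by (simp add: tensors_def) (simp add: hat_def)
qed

text \<open>A permutation of the positions acts bijectively on the ordered pairs of distinct
  positions, so it only reindexes the outer sum.\<close>

lemma hat_permute_list:
  assumes "\<pi> permutes {..<k}" "length vs = k"
  shows "hat k X \<alpha> (permute_list \<pi> vs) = hat k X (\<lambda>ws. \<alpha> (permute_list \<pi> ws)) vs"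
proof -
  have inj: "\<pi> i = \<pi> j \<longleftrightarrow> i = j" for i j
    using permutes_inj[OF assms(1)] by (auto dest: injD)
  have lt: "\<pi> i < k \<longleftrightarrow> i < k" for i
    using permutes_in_image[OF assms(1), of i] by simp
  \<comment> \<open>Entry \<open>r\<close> of the permuted list is entry \<open>\<pi> r\<close> of
    the original; hence an update at \<open>\<pi> r\<close> becomes one at \<open>r\<close>.\<close>
  have upd: "permute_list \<pi> (ws[\<pi> r := p]) = (permute_list \<pi> ws)[r := p]"
    if "length ws = k" "r < k" for ws r and p :: 'a
    using that lt by (intro nth_equalityI) (auto simp: permute_list_def nth_list_update inj)
  \<comment> \<open>Finiteness makes the injective self-map on pairs surjective.\<close>
  have "finite {(r, s). r < k \<and> s < k \<and> r \<noteq> s}"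
    by (rule finite_subset[of _ "{..<k} \<times> {..<k}"]) auto
  then have bij: "bij_betw (\<lambda>(r, s). (\<pi> r, \<pi> s)) {(r, s). r < k \<and> s < k \<and> r \<noteq> s}
      {(r, s). r < k \<and> s < k \<and> r \<noteq> s}"
    unfolding bij_betw_def by (intro conjI endo_inj_surj) (auto simp: lt inj inj_on_def)
  have "(\<Sum>(r, s) \<in> {(r, s). r < k \<and> s < k \<and> r \<noteq> s}.
      \<Sum>p\<in>Basis. \<Sum>q\<in>Basis. X [p, vs ! r, vs ! s, q] * \<alpha> (permute_list \<pi> (vs[r := p, s := q]))) =
    (\<Sum>(r, s) \<in> {(r, s). r < k \<and> s < k \<and> r \<noteq> s}.
      \<Sum>p\<in>Basis. \<Sum>q\<in>Basis. X [p, vs ! \<pi> r, vs ! \<pi> s, q] * \<alpha> (permute_list \<pi> (vs[\<pi> r := p, \<pi> s := q])))"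
    by (subst sum.reindex_bij_betw[OF bij, symmetric]) (simp add: split_def)
  also have "\<dots> = (\<Sum>(r, s) \<in> {(r, s). r < k \<and> s < k \<and> r \<noteq> s}.
      \<Sum>p\<in>Basis. \<Sum>q\<in>Basis. X [p, permute_list \<pi> vs ! r, permute_list \<pi> vs ! s, q] *
        \<alpha> ((permute_list \<pi> vs)[r := p, s := q]))"
    using assms by (intro sum.cong refl) (auto simp: upd permute_list_nth)
  finally show ?thesis
    using assms(2) by (simp add: hat_def)
qed

text \<open>After \<open>hat_permute_list\<close>, the permutation acts on \<open>\<alpha>\<close>
  only, and linearity of \<open>hat\<close> in \<open>\<alpha>\<close> brings the signed average
  inside. An equation between antisymmetrizations of \<open>\<alpha>\<close> thus carries over to
  \<open>hat k X \<alpha>\<close>.\<close>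

lemma antisymmetrize_hat:
  assumes "S \<subseteq> {..<k}"
  shows "antisymmetrize S (hat k X \<alpha>) = hat k X (antisymmetrize S \<alpha>)"
proof
  fix vs :: "'a list"
  let ?P = "{\<pi>. \<pi> permutes S}" and ?R = "{(r, s). r < k \<and> s < k \<and> r \<noteq> s}"
  show "antisymmetrize S (hat k X \<alpha>) vs = hat k X (antisymmetrize S \<alpha>) vs"
  proof (cases "length vs = k")
    case False
    then show ?thesis by (simp add: antisymmetrize_def hat_def)
  next
    case True
    have "(\<Sum>\<pi>\<in>?P. of_int (sign \<pi>) * hat k X \<alpha> (permute_list \<pi> vs)) =
      (\<Sum>\<pi>\<in>?P. of_int (sign \<pi>) * hat k X (\<lambda>ws. \<alpha> (permute_list \<pi> ws)) vs)"
      using True assms by (intro sum.cong refl) (auto simp: hat_permute_list dest: permutes_subset)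
    also have "\<dots> = 1 / real k * (\<Sum>\<pi>\<in>?P. \<Sum>(r, s)\<in>?R. \<Sum>p\<in>Basis. \<Sum>q\<in>Basis.
        X [p, vs ! r, vs ! s, q] * (of_int (sign \<pi>) * \<alpha> (permute_list \<pi> (vs[r := p, s := q]))))"
      using True by (simp add: hat_def sum_distrib_left split_def mult_ac)
    \<comment> \<open>The sum over permutations moves past the pairs and then past both contracted
      indices.\<close>
    also have "\<dots> = 1 / real k * (\<Sum>(r, s)\<in>?R. \<Sum>p\<in>Basis. \<Sum>q\<in>Basis. \<Sum>\<pi>\<in>?P.
        X [p, vs ! r, vs ! s, q] * (of_int (sign \<pi>) * \<alpha> (permute_list \<pi> (vs[r := p, s := q]))))"
      unfolding split_def
      by (subst sum.swap[of _ _ ?P], intro arg_cong[where f = "(*) _"] sum.cong refl,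
          subst sum.swap[of _ _ ?P], intro sum.cong refl sum.swap)
    finally have "antisymmetrize S (hat k X \<alpha>) vs = 1 / real k * (\<Sum>(r, s)\<in>?R. \<Sum>p\<in>Basis. \<Sum>q\<in>Basis. \<Sum>\<pi>\<in>?P.
        X [p, vs ! r, vs ! s, q] * (of_int (sign \<pi>) * \<alpha> (permute_list \<pi> (vs[r := p, s := q])))) / fact (card S)"
      by (simp only: antisymmetrize_def)
    also have "\<dots> = hat k X (antisymmetrize S \<alpha>) vs"
      using True
      by (simp add: antisymmetrize_def hat_def split_def sum_distrib_left[symmetric] sum_divide_distrib[symmetric])
    finally show ?thesis .
  qed
qed

lemma hat_0: "hat k X 0 = 0"
  by (auto simp: hat_def zero_fun_def fun_eq_iff)

lemma curv_mult_MC: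
  assumes "X \<in> tensors 4" "Y \<in> MC"
  shows "curv_mult X Y \<in> MC"
  using assms by (auto simp: MC_def curv_mult_def hat_mem_tensors antisymmetrize_hat hat_0)

text \<open>The twelve ordered pairs of positions, each \<open>(r, s)\<close> with
  \<open>r < s\<close> followed by \<open>(s, r)\<close>. The closure proofs below treat these
  summands individually.\<close>

lemma curv_mult_components:
  "curv_mult X Y [a, b, c, d] = 1 / 4 * (
    (\<Sum>p\<in>Basis. \<Sum>q\<in>Basis. X [p, a, b, q] * Y [p, q, c, d]) +
    (\<Sum>p\<in>Basis. \<Sum>q\<in>Basis. X [p, b, a, q] * Y [q, p, c, d]) +
    (\<Sum>p\<in>Basis. \<Sum>q\<in>Basis. X [p, a, c, q] * Y [p, b, q, d]) +
    (\<Sum>p\<in>Basis. \<Sum>q\<in>Basis. X [p, c, a, q] * Y [q, b, p, d]) +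
    (\<Sum>p\<in>Basis. \<Sum>q\<in>Basis. X [p, a, d, q] * Y [p, b, c, q]) +
    (\<Sum>p\<in>Basis. \<Sum>q\<in>Basis. X [p, d, a, q] * Y [q, b, c, p]) +
    (\<Sum>p\<in>Basis. \<Sum>q\<in>Basis. X [p, b, c, q] * Y [a, p, q, d]) +
    (\<Sum>p\<in>Basis. \<Sum>q\<in>Basis. X [p, c, b, q] * Y [a, q, p, d]) +
    (\<Sum>p\<in>Basis. \<Sum>q\<in>Basis. X [p, b, d, q] * Y [a, p, c, q]) +
    (\<Sum>p\<in>Basis. \<Sum>q\<in>Basis. X [p, d, b, q] * Y [a, q, c, p]) +
    (\<Sum>p\<in>Basis. \<Sum>q\<in>Basis. X [p, c, d, q] * Y [a, b, p, q]) +
    (\<Sum>p\<in>Basis. \<Sum>q\<in>Basis. X [p, d, c, q] * Y [a, b, q, p]))"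
proof -
  have less_4: "r < 4 \<longleftrightarrow> r = 0 \<or> r = 1 \<or> r = 2 \<or> r = 3" for r :: nat
    by auto
  have "{(r, s). r < 4 \<and> s < 4 \<and> r \<noteq> s} = {(0, 1), (1, 0), (0, 2), (2, 0), (0, 3), (3, 0),
      (1, 2), (2, 1), (1, 3), (3, 1), (2, 3), (3::nat, 2::nat)}"
    by (auto simp: less_4)
  then show ?thesis
    by (simp add: curv_mult_def hat_def)
qed

section \<open>Vanishing of the Ricci trace of a product\<close>

lemma curv_mult_MC_W:
  assumes X: "X \<in> MC_W" and Y: "Y \<in> MC_W"
  shows "curv_mult X Y \<in> MC_W"
proof -
  have XM: "X \<in> MC" and YM: "Y \<in> MC" and "ricci X = 0" "ricci Y = 0"
    using X Y by (auto simp: MC_W_def)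
  then have RX: "(\<Sum>p\<in>Basis. X [p, x, y, p]) = 0" and RY: "(\<Sum>p\<in>Basis. Y [p, x, y, p]) = 0" for x y
    by (auto dest!: fun_cong[where x = "[x, y]"] simp: ricci_def)
  note X2 = MC_D(2)[OF XM] and X3 = MC_D(3)[OF XM]
  \<comment> \<open>Applying both antisymmetries moves the trace from the outer to the inner
    arguments without a sign.\<close>
  have RX': "(\<Sum>p\<in>Basis. X [x, p, p, y]) = 0" for x y
    using RX[of x y] X2 X3 by (metis (mono_tags, lifting) minus_equation_iff sum.cong)
  have swap: "(\<Sum>e\<in>Basis. \<Sum>p\<in>Basis. \<Sum>q\<in>Basis. F e p q) = (\<Sum>p\<in>Basis. \<Sum>q\<in>Basis. \<Sum>e\<in>Basis. F e p q)"
    for F :: "'a \<Rightarrow> 'a \<Rightarrow> 'a \<Rightarrow> real"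
    by (subst sum.swap) (intro sum.cong refl sum.swap)
  have swap': "(\<Sum>e\<in>Basis. \<Sum>p\<in>Basis. \<Sum>q\<in>Basis. F e p q) = (\<Sum>e\<in>Basis. \<Sum>q\<in>Basis. \<Sum>p\<in>Basis. F e p q)"
    for F :: "'a \<Rightarrow> 'a \<Rightarrow> 'a \<Rightarrow> real"
    by (intro sum.cong refl sum.swap)
  \<comment> \<open>The traced positions are 0 and 3. For \<open>s\<close> equal to 1 or 2, the
    pairs \<open>(0, s)\<close> and \<open>(3, s)\<close> share one factor \<open>X\<close>,
    antisymmetric in \<open>p\<close> and \<open>e\<close>, while the two factors \<open>G\<close>
    add up to something symmetric in them.\<close>
  have left: "(\<Sum>e\<in>Basis. \<Sum>p\<in>Basis. \<Sum>q\<in>Basis. X [p, e, z, q] * G p q e) +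
      (\<Sum>e\<in>Basis. \<Sum>p\<in>Basis. \<Sum>q\<in>Basis. X [p, e, z, q] * G e q p) = 0" for z G
    unfolding sum.distrib[symmetric] distrib_left[symmetric]
    by (rule sum_antisymmetric_eq_0, subst X2) (simp add: sum_negf add.commute)
  \<comment> \<open>The same for the pairs \<open>(s, 0)\<close> and \<open>(s, 3)\<close>, now with
    the last two arguments of \<open>X\<close> and the indices \<open>e\<close> and
    \<open>q\<close>.\<close>
  have right: "(\<Sum>e\<in>Basis. \<Sum>p\<in>Basis. \<Sum>q\<in>Basis. X [p, z, e, q] * G q p e) +
      (\<Sum>e\<in>Basis. \<Sum>p\<in>Basis. \<Sum>q\<in>Basis. X [p, z, e, q] * G e p q) = 0" for z G
    unfolding sum.distrib[symmetric] distrib_left[symmetric]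
    by (subst swap', rule sum_antisymmetric_eq_0, subst X3) (simp add: sum_negf add.commute)
  have "(\<Sum>e\<in>Basis. curv_mult X Y [e, x, y, e]) = 0" for x y
  proof -
    \<comment> \<open>The pairs within \<open>{0, 3}\<close> produce a trace of \<open>X\<close>,
      those within \<open>{1, 2}\<close> a trace of \<open>Y\<close>.\<close>
    have "(\<Sum>e\<in>Basis. \<Sum>p\<in>Basis. \<Sum>q\<in>Basis. X [p, e, e, q] * Y [p, x, y, q]) = 0"
      "(\<Sum>e\<in>Basis. \<Sum>p\<in>Basis. \<Sum>q\<in>Basis. X [p, e, e, q] * Y [q, x, y, p]) = 0"
      "(\<Sum>e\<in>Basis. \<Sum>p\<in>Basis. \<Sum>q\<in>Basis. X [p, x, y, q] * Y [e, p, q, e]) = 0"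
      "(\<Sum>e\<in>Basis. \<Sum>p\<in>Basis. \<Sum>q\<in>Basis. X [p, y, x, q] * Y [e, q, p, e]) = 0"
      by (simp_all add: swap RX' RY sum_distrib_left[symmetric] sum_distrib_right[symmetric])
    then show ?thesis
      using left[of x "\<lambda>p q e. Y [p, q, y, e]"] left[of y "\<lambda>p q e. Y [p, x, q, e]"]
        right[of x "\<lambda>q p e. Y [q, p, y, e]"] right[of y "\<lambda>q p e. Y [q, x, p, e]"]
      by (simp add: curv_mult_components sum.distrib sum_distrib_left[symmetric] sum_divide_distrib[symmetric])
  qed
  then have "ricci (curv_mult X Y) = 0"
    by (auto simp: ricci_def fun_eq_iff zero_fun_def split: list.split)
  then show ?thesis
    using curv_mult_MC[OF MC_D(1)[OF XM] YM] by (simp add: MC_W_def)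
qed


subsection \<open>The complex structure\<close>

lemma kaehler_D:
  assumes "kaehler_vector_space n J \<omega>"
  shows "linear J" "J (J x) = - x" "orthogonal_transformation J"
  using assms by (auto simp: kaehler_vector_space_def orthogonal_transformation_def)

text \<open>Pair symmetry carries the invariance over to the last two arguments.\<close>

lemma MC_K_D:
  assumes "X \<in> MC_K J"
  shows "X \<in> MC" "X [J x, J y, z, w] = X [x, y, z, w]" "X [x, y, J z, J w] = X [x, y, z, w]"
  using assms MC_pair_symmetry[of X] by (auto simp: MC_K_def)

text \<open>Vanishing of the antisymmetrization says that \<open>J\<close> may be moved between the
  first two arguments after exchanging them. Replacing one argument by its image under
  \<open>J\<close> and using that \<open>J\<close> squares to minus the identity converts this into
  invariance and back; antisymmetry of \<open>X\<close> fixes the sign.\<close>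

lemma MC_K_eq:
  assumes "kaehler_vector_space n J \<omega>"
  shows "MC_K J = {X \<in> MC. antisymmetrize {0, 1} (J_contraction J X) = 0}"
proof -
  have "(\<forall>x y z w. X [J x, J y, z, w] = X [x, y, z, w]) \<longleftrightarrow>
      antisymmetrize {0, 1} (J_contraction J X) = 0" if X: "X \<in> MC" for X
  proof -
    have "antisymmetrize {0, 1} (J_contraction J X) = 0 \<longleftrightarrow>
        (\<forall>x y z w. antisymmetrize {0, 1} (J_contraction J X) [x, y, z, w] = 0)"
    proof (intro iffI ext)
      fix vs :: "'a list"
      assume *: "\<forall>x y z w. antisymmetrize {0, 1} (J_contraction J X) [x, y, z, w] = 0"
      show "antisymmetrize {0, 1} (J_contraction J X) vs = 0 vs"
      proof (cases "length vs = 4")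
        case True
        then show ?thesis using * by (auto elim: length_4_cases)
      next
        case False
        \<comment> \<open>Permuting a list keeps its length, so every term of the antisymmetrization
          is the default value 0.\<close>
        then have "J_contraction J X ws = 0" if "length ws = length vs" for ws
          using that by (auto simp: J_contraction_def split: list.split)
        then show ?thesis
          by (simp add: antisymmetrize_def)
      qed
    qed simp
    also have "\<dots> \<longleftrightarrow> (\<forall>x y z w. X [y, J x, z, w] = X [x, J y, z, w])"
      by (simp add: antisymmetrize_pair permute_list_simps_4 Transposition.transpose_def J_contraction_def)
    also have "\<dots> \<longleftrightarrow> (\<forall>x y z w. X [J x, J y, z, w] = X [x, y, z, w])"
    proof -
      have neg: "X [a, - b, c, d] = - X [a, b, c, d]" for a b c d
        using linear_neg[OF tensors_4_linear(2)[OF MC_D(1)[OF X]]] .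
      note anti = MC_D(2)[OF X] and JJ = kaehler_D(2)[OF assms]
      show ?thesis
      proof (intro iffI allI)
        fix x y z w
        assume "\<forall>x y z w. X [y, J x, z, w] = X [x, J y, z, w]"
        then have "X [J x, J y, z, w] = X [y, J (J x), z, w]"
          by simp
        then show "X [J x, J y, z, w] = X [x, y, z, w]"
          using anti[of y x z w] by (simp add: JJ neg)
      next
        fix x y z w
        assume "\<forall>x y z w. X [J x, J y, z, w] = X [x, y, z, w]"
        then have "X [x, J y, z, w] = X [J x, J (J y), z, w]"
          by simp
        then show "X [y, J x, z, w] = X [x, J y, z, w]"
          using anti[of y "J x" z w] by (simp add: JJ neg)
      qed
    qed
    finally show ?thesis by simp
  qed
  then show ?thesis unfolding MC_K_def by blast
qed

lemma subspace_MC_K: "subspace (MC_K J)"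
  using subspace_MC unfolding subspace_def MC_K_def
  by (auto simp: scaleR_fun_def plus_fun_def zero_fun_def)

lemma subspace_MC_W: "subspace (MC_W :: ('a::euclidean_space list \<Rightarrow> real) set)"
proof -
  have "ricci (X + Y) = ricci X + ricci Y" "ricci (c *\<^sub>R X) = c *\<^sub>R ricci X" "ricci 0 = 0"
    for X Y :: "'a list \<Rightarrow> real" and c
    by (auto simp: ricci_def fun_eq_iff scaleR_fun_def plus_fun_def zero_fun_def sum.distrib
        sum_distrib_left split: list.split)
  then show ?thesis
    using subspace_MC unfolding subspace_def MC_W_def by auto
qed

section \<open>Closure of the \<open>J\<close>-invariant tensors under the product\<close>

lemma curv_mult_MC_K:
  assumes J: "orthogonal_transformation J" and X: "X \<in> MC_K J" and Y: "Y \<in> MC_K J"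
  shows "curv_mult X Y \<in> MC_K J"
proof -
  have XM: "X \<in> MC" and YM: "Y \<in> MC"
    using X Y by (auto simp: MC_K_def)
  note linX = tensors_4_linear[OF MC_D(1)[OF XM]] and linY = tensors_4_linear[OF MC_D(1)[OF YM]]
  note KX = MC_K_D(2,3)[OF X] and KY = MC_K_D(2,3)[OF Y]
  \<comment> \<open>Replacing the index \<open>p\<close> by \<open>J p\<close> removes
    \<open>J\<close> from \<open>X\<close> by invariance and puts one on the
    \<open>p\<close>-argument of \<open>G\<close>. In the applications that argument shares an
    invariant pair of \<open>Y\<close> with another \<open>J\<close>; \<open>H\<close> is the result
    of cancelling both.\<close>
  have inv_p: "(\<Sum>p\<in>Basis. \<Sum>q\<in>Basis. X [p, J u, v, q] * G q p) =
      (\<Sum>p\<in>Basis. \<Sum>q\<in>Basis. X [p, u, v, q] * H q p)"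
    if "\<And>q. linear (G q)" "\<And>q p. G q (J p) = H q p" for u v G H
  proof -
    have "(\<Sum>p\<in>Basis. X [p, J u, v, q] * G q p) = (\<Sum>p\<in>Basis. X [p, u, v, q] * H q p)" for q
      using sum_orthogonal_invariant[OF J bilinear_mult[OF linX(1) that(1)], of "J u" v q q]
      by (simp add: that(2) KX)
    then show ?thesis
      by (subst (1 2) sum.swap) simp
  qed
  have inv_q: "(\<Sum>p\<in>Basis. \<Sum>q\<in>Basis. X [p, v, J u, q] * G p q) =
      (\<Sum>p\<in>Basis. \<Sum>q\<in>Basis. X [p, v, u, q] * H p q)"
    if "\<And>p. linear (G p)" "\<And>q p. G p (J q) = H p q" for u v G H
  proof -
    have "(\<Sum>q\<in>Basis. X [p, v, J u, q] * G p q) = (\<Sum>q\<in>Basis. X [p, v, u, q] * H p q)" for p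
      using sum_orthogonal_invariant[OF J bilinear_mult[OF linX(4) that(1)], of p v "J u" p]
      by (simp add: that(2) KX)
    then show ?thesis by simp
  qed
  \<comment> \<open>For the positions 0 and 1 both copies of \<open>J\<close> land on
    \<open>u\<close> and \<open>v\<close>, which lie in different pairs of \<open>X\<close>. Against
    the antisymmetric \<open>Y [p, q, z, w]\<close> only the part of \<open>X [p, u, v, q]\<close>
    antisymmetric in \<open>p\<close> and \<open>q\<close> survives; the Bianchi identity rewrites
    it with \<open>u\<close> and \<open>v\<close> in one pair.\<close>
  have pair: "(\<Sum>p\<in>Basis. \<Sum>q\<in>Basis. X [p, u, v, q] * Y [p, q, z, w]) =
      (\<Sum>p\<in>Basis. \<Sum>q\<in>Basis. X [q, p, u, v] * Y [p, q, z, w]) / 2" for u v z w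
  proof -
    have bianchi: "X [q, p, u, v] = X [p, u, v, q] - X [q, u, v, p]" for p q
      using MC_D(4)[OF XM, of p u q v] MC_D(3)[OF XM, of p u v q] MC_D(3)[OF XM, of q u v p]
        MC_D(2)[OF XM, of u q p v] by linarith
    have "(\<Sum>p\<in>Basis. \<Sum>q\<in>Basis. (X [p, u, v, q] + X [q, u, v, p]) * Y [p, q, z, w]) = 0"
      by (rule sum_antisymmetric_eq_0, subst MC_D(2)[OF YM]) simp
    then show ?thesis
      by (simp add: bianchi algebra_simps sum.distrib sum_subtractf)
  qed
  have pair': "(\<Sum>p\<in>Basis. \<Sum>q\<in>Basis. X [p, v, u, q] * Y [q, p, z, w]) =
      - (\<Sum>p\<in>Basis. \<Sum>q\<in>Basis. X [p, v, u, q] * Y [p, q, z, w])" for u v z w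
    by (subst MC_D(2)[OF YM]) (simp add: sum_negf)
  \<comment> \<open>Invariance of \<open>X\<close> settles the pairs within \<open>{0, 1}\<close>
    once they are rewritten, and invariance of \<open>Y\<close> those within \<open>{2, 3}\<close>.
    The eight mixed pairs are the eight instances of \<open>inv_p\<close> and
    \<open>inv_q\<close>.\<close>
  have "curv_mult X Y [J a, J b, c, d] = curv_mult X Y [a, b, c, d]" for a b c d
    unfolding curv_mult_components pair' pair KX KY
    by (simp add: inv_p[of "\<lambda>q p. Y [p, J b, q, d]" "\<lambda>q p. Y [p, b, q, d]"]
        inv_p[of "\<lambda>q p. Y [p, J b, c, q]" "\<lambda>q p. Y [p, b, c, q]"]
        inv_p[of "\<lambda>q p. Y [J a, p, q, d]" "\<lambda>q p. Y [a, p, q, d]"]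
        inv_p[of "\<lambda>q p. Y [J a, p, c, q]" "\<lambda>q p. Y [a, p, c, q]"]
        inv_q[of "\<lambda>p q. Y [q, J b, p, d]" "\<lambda>p q. Y [q, b, p, d]"]
        inv_q[of "\<lambda>p q. Y [q, J b, c, p]" "\<lambda>p q. Y [q, b, c, p]"]
        inv_q[of "\<lambda>p q. Y [J a, q, p, d]" "\<lambda>p q. Y [a, q, p, d]"]
        inv_q[of "\<lambda>p q. Y [J a, q, c, p]" "\<lambda>p q. Y [a, q, c, p]"]
        linY KY)
  then show ?thesis
    using curv_mult_MC[OF MC_D(1)[OF XM] YM] by (simp add: MC_K_def)
qed


subsection \<open>The action of the unitary group\<close>

lemma unitary_group_D:
  assumes "g \<in> unitary_group J"
  shows "orthogonal_transformation g" "bij g" "g (J x) = J (g x)"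
  using assms by (auto simp: unitary_group_def orthogonal_transformation_def)

lemma unitary_group_inv:
  assumes "g \<in> unitary_group J"
  shows "inv g \<in> unitary_group J"
proof -
  note g = unitary_group_D[OF assms]
  have "inv g (J x) = J (inv g x)" for x
    using g(2,3) by (metis bij_inv_eq_iff)
  then show ?thesis
    using orthogonal_transformation_inv[OF g(1)] bij_imp_bij_inv[OF g(2)]
    by (simp add: unitary_group_def orthogonal_transformation_def)
qed

lemma tensor_act_mem_tensors:
  assumes "linear (inv g)" "\<alpha> \<in> tensors k"
  shows "tensor_act g \<alpha> \<in> tensors k"
  using assms
  by (auto simp: tensors_def tensor_act_def map_update intro!: linear_compose[unfolded comp_def, of "inv g"])

lemma antisymmetrize_tensor_act:
  assumes "S \<subseteq> {..<k}" "\<alpha> \<in> tensors k"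
  shows "antisymmetrize S (tensor_act g \<alpha>) = tensor_act g (antisymmetrize S \<alpha>)"
proof
  fix vs
  have "\<alpha> (map (inv g) (permute_list \<pi> vs)) = \<alpha> (permute_list \<pi> (map (inv g) vs))"
    if "\<pi> permutes S" for \<pi>
  \<comment> \<open>On a list of another length a permutation of \<open>S\<close> may point beyond
    its end, where \<open>permute_list\<close> need not commute with \<open>map\<close>; there
    \<open>\<alpha>\<close> vanishes on both sides.\<close>
  proof (cases "length vs = k")
    case True
    then show ?thesis
      using permutes_subset[OF that assms(1)] by (simp add: permute_list_map)
  qed (simp add: tensors_eq_0[OF assms(2)])
  then show "antisymmetrize S (tensor_act g \<alpha>) vs = tensor_act g (antisymmetrize S \<alpha>) vs"
    by (simp add: antisymmetrize_def tensor_act_def)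
qed

lemma tensor_act_hat:
  assumes g: "orthogonal_transformation (inv g)" and X: "X \<in> tensors 4" and \<alpha>: "\<alpha> \<in> tensors k"
  shows "tensor_act g (hat k X \<alpha>) = hat k (tensor_act g X) (tensor_act g \<alpha>)"
proof
  fix vs
  define h where "h = inv g"
  have h: "orthogonal_transformation h"
    using g by (simp add: h_def)
  \<comment> \<open>The change of basis is made first in \<open>q\<close>, then in \<open>p\<close>,
    each time with the other index held fixed.\<close>
  have "(\<Sum>p\<in>Basis. \<Sum>q\<in>Basis. X [p, u, v, q] * \<alpha> (ws[r := p, s := q])) =
      (\<Sum>p\<in>Basis. \<Sum>q\<in>Basis. X [h p, u, v, h q] * \<alpha> (ws[r := h p, s := h q]))"
    if "length ws = k" "r < k" "s < k" "r \<noteq> s" for u v ws r s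
  proof -
    have lr: "linear (\<lambda>p. \<alpha> (ws[r := p, s := q]))" for q
      using that tensors_linear[OF \<alpha>, of "ws[s := q]" r] by (simp add: list_update_swap)
    have ls: "linear (\<lambda>q. \<alpha> (ws[r := p, s := q]))" for p
      using that tensors_linear[OF \<alpha>, of "ws[r := p]" s] by simp
    have "(\<Sum>p\<in>Basis. \<Sum>q\<in>Basis. X [p, u, v, q] * \<alpha> (ws[r := p, s := q])) =
        (\<Sum>p\<in>Basis. \<Sum>q\<in>Basis. X [p, u, v, h q] * \<alpha> (ws[r := p, s := h q]))"
      by (intro sum.cong refl
          sum_orthogonal_invariant[OF h bilinear_mult[OF tensors_4_linear(4)[OF X] ls], symmetric])
    also have "\<dots> = (\<Sum>q\<in>Basis. \<Sum>p\<in>Basis. X [p, u, v, h q] * \<alpha> (ws[r := p, s := h q]))"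
      by (rule sum.swap)
    also have "\<dots> = (\<Sum>q\<in>Basis. \<Sum>p\<in>Basis. X [h p, u, v, h q] * \<alpha> (ws[r := h p, s := h q]))"
      by (intro sum.cong refl
          sum_orthogonal_invariant[OF h bilinear_mult[OF tensors_4_linear(1)[OF X] lr], symmetric])
    also have "\<dots> = (\<Sum>p\<in>Basis. \<Sum>q\<in>Basis. X [h p, u, v, h q] * \<alpha> (ws[r := h p, s := h q]))"
      by (rule sum.swap)
    finally show ?thesis .
  qed
  note basis_change = this
  show "tensor_act g (hat k X \<alpha>) vs = hat k (tensor_act g X) (tensor_act g \<alpha>) vs"
  proof (cases "length vs = k")
    case True
    have "(\<Sum>(r, s) \<in> {(r, s). r < k \<and> s < k \<and> r \<noteq> s}. \<Sum>p\<in>Basis. \<Sum>q\<in>Basis.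
        X [p, map h vs ! r, map h vs ! s, q] * \<alpha> ((map h vs)[r := p, s := q])) =
      (\<Sum>(r, s) \<in> {(r, s). r < k \<and> s < k \<and> r \<noteq> s}. \<Sum>p\<in>Basis. \<Sum>q\<in>Basis.
        X [h p, h (vs ! r), h (vs ! s), h q] * \<alpha> (map h (vs[r := p, s := q])))"
    proof (rule sum.cong[OF refl], clarify)
      fix r s assume "r < k" "s < k" "r \<noteq> s"
      then show "(\<Sum>p\<in>Basis. \<Sum>q\<in>Basis.
          X [p, map h vs ! r, map h vs ! s, q] * \<alpha> ((map h vs)[r := p, s := q])) =
        (\<Sum>p\<in>Basis. \<Sum>q\<in>Basis. X [h p, h (vs ! r), h (vs ! s), h q] * \<alpha> (map h (vs[r := p, s := q])))"
        using True basis_change[of "map h vs" r s] by (simp add: map_update)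
    qed
    then show ?thesis
      using True by (simp add: tensor_act_def hat_def h_def[symmetric])
  qed (simp add: tensor_act_def hat_def)
qed

lemma tensor_act_MC:
  assumes "linear (inv g)" "X \<in> MC"
  shows "tensor_act g X \<in> MC"
proof -
  have "tensor_act g 0 = 0"
    by (simp add: tensor_act_def zero_fun_def)
  then show ?thesis
    using assms by (simp add: MC_def tensor_act_mem_tensors antisymmetrize_tensor_act[of _ 4])
qed

text \<open>The Ricci trace of the transformed tensor is that of \<open>X\<close> taken in another
  orthonormal basis, at transformed arguments.\<close>

lemma tensor_act_MC_W:
  assumes g: "orthogonal_transformation (inv g)" and X: "X \<in> MC_W"
  shows "tensor_act g X \<in> MC_W"
proof -
  have XM: "X \<in> MC" and "ricci X = 0"
    using X by (auto simp: MC_W_def)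
  then have "(\<Sum>p\<in>Basis. X [p, x, y, p]) = 0" for x y
    by (auto dest!: fun_cong[where x = "[x, y]"] simp: ricci_def)
  moreover have "bilinear (\<lambda>p q. X [p, x, y, q])" for x y
    using tensors_4_linear[OF MC_D(1)[OF XM]] by (simp add: bilinear_def)
  ultimately have "(\<Sum>p\<in>Basis. X [inv g p, x, y, inv g p]) = 0" for x y
    using sum_orthogonal_invariant[OF g, of "\<lambda>p q. X [p, x, y, q]"] by simp
  then have "ricci (tensor_act g X) = 0"
    by (auto simp: ricci_def tensor_act_def fun_eq_iff zero_fun_def split: list.split)
  then show ?thesis
    using tensor_act_MC[OF orthogonal_transformation_linear[OF g] XM] by (simp add: MC_W_def)
qed

text \<open>The action evaluates at \<open>inv g\<close>, which is again unitary and therefore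
  commutes with \<open>J\<close>.\<close>

lemma submodule_MC_K: "submodule_of (unitary_group J) tensor_act MC (MC_K J)"
  unfolding submodule_of_def
proof (intro conjI ballI)
  show "MC_K J \<subseteq> MC" by (auto simp: MC_K_def)
  fix g X assume g: "g \<in> unitary_group J" and X: "X \<in> MC_K J"
  note h = unitary_group_D[OF unitary_group_inv[OF g]]
  show "tensor_act g X \<in> MC_K J"
    using tensor_act_MC[OF orthogonal_transformation_linear[OF h(1)]] X
    by (simp add: MC_K_def h(3) tensor_act_def)
qed (rule subspace_MC_K)

lemma submodule_MC_KW: "submodule_of (unitary_group J) tensor_act MC (MC_KW J)"
  using submodule_MC_K[of J] subspace_inter[OF subspace_MC_K subspace_MC_W, of J]
    tensor_act_MC_W[OF unitary_group_D(1)[OF unitary_group_inv]]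
  by (auto simp: submodule_of_def MC_KW_def)

text \<open>Stated for any submodule \<open>B\<close> of \<open>MC\<close> so as to serve both
  \<open>MC_K J\<close> and \<open>MC_KW J\<close>. Bijectivity on \<open>B\<close> comes from the
  action of \<open>inv g\<close>, which also preserves \<open>B\<close>; multiplicativity is the
  equivariance of \<open>hat\<close>.\<close>

lemma acts_by_automorphisms_submodule:
  assumes sub: "submodule_of (unitary_group J) tensor_act MC B"
  shows "acts_by_automorphisms (unitary_group J) tensor_act B curv_mult"
  unfolding acts_by_automorphisms_def
proof (intro conjI ballI)
  fix g assume g: "g \<in> unitary_group J"
  note h = unitary_group_inv[OF g]
  have cancel: "tensor_act g (tensor_act (inv g) X) = X" "tensor_act (inv g) (tensor_act g X) = X" for X
    using unitary_group_D(2)[OF g]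
    by (simp_all add: tensor_act_def comp_def inv_inv_eq bij_is_inj bij_is_surj surj_f_inv_f)
  have "bij_betw (tensor_act g) B B"
    using sub g h by (intro bij_betwI[of _ _ _ "tensor_act (inv g)"]) (auto simp: submodule_of_def cancel)
  moreover have "B \<subseteq> tensors 4"
    using sub by (auto simp: submodule_of_def MC_def)
  then have "tensor_act g (curv_mult X Y) = curv_mult (tensor_act g X) (tensor_act g Y)"
    if "X \<in> B" "Y \<in> B" for X Y
    using tensor_act_hat[OF unitary_group_D(1)[OF h]] that unfolding curv_mult_def by blast
  ultimately show "algebra_automorphism B curv_mult (tensor_act g)"
    unfolding algebra_automorphism_def by (auto simp: tensor_act_def plus_fun_def scaleR_fun_def)
next
  fix g g' X assume "g \<in> unitary_group J" "g' \<in> unitary_group J"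
  then show "tensor_act (g \<circ> g') X = tensor_act g (tensor_act g' X)"
    by (simp add: tensor_act_def o_inv_distrib unitary_group_D(2))
qed (simp add: tensor_act_def)

theorem lemma11p1:
  fixes n :: nat
    and J :: "'a::euclidean_space \<Rightarrow> 'a"
    and \<omega> :: "'a \<Rightarrow> 'a \<Rightarrow> real"
  assumes "kaehler_vector_space n J \<omega>"
  shows "MC_K J = {X \<in> MC. antisymmetrize {0, 1} (J_contraction J X) = 0} \<and>
    submodule_of (unitary_group J) tensor_act MC (MC_K J) \<and>
    submodule_of (unitary_group J) tensor_act MC (MC_KW J) \<and>
    subalgebra_of MC curv_mult (MC_K J) \<and>
    subalgebra_of MC curv_mult (MC_KW J) \<and>
    acts_by_automorphisms (unitary_group J) tensor_act (MC_K J) curv_mult \<and>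
    acts_by_automorphisms (unitary_group J) tensor_act (MC_KW J) curv_mult"
proof (intro conjI)
  note mult_K = curv_mult_MC_K[OF kaehler_D(3)[OF assms]]
  show "subalgebra_of MC curv_mult (MC_K J)"
    using submodule_MC_K[of J] mult_K by (auto simp: subalgebra_of_def submodule_of_def)
  show "subalgebra_of MC curv_mult (MC_KW J)"
    using submodule_MC_KW[of J] mult_K curv_mult_MC_W
    by (auto simp: subalgebra_of_def submodule_of_def MC_KW_def)
qed (rule MC_K_eq[OF assms] submodule_MC_K submodule_MC_KW acts_by_automorphisms_submodule)+

end
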